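(* Let $G$ be a finite simple connected graph with $n$ vertices and $m$ edges. Let $T_1(G)$ be its semitotal-point graph and $T_2(G)$ its semitotal-line graph. Then (i) $F(T_1(G)) = 8F(G)+8m$; (ii) $F(T_2(G)) = F(G)+\xi_4(G)+3\,\mathrm{ReZG}_3(G)$.
   Context: For a finite simple graph $H$ with vertex set $V(H)$ and edge set $E(H)$, $d_H(v)$ denotes the degree of the vertex $v$ in $H$. The F-index of $H$ is $F(H)=\sum_{v\in V(H)} d_H(v)^3$. Further, $\xi_4(H)=\sum_{v\in V(H)} d_H(v)^4=\sum_{uv\in E(H)}[d_H(u)^3+d_H(v)^3]$ and $\mathrm{ReZG}_3(H)=\sum_{uv\in E(H)} d_H(u)d_H(v)[d_H(u)+d_H(v)]$. The semitotal-point graph $T_1(G)$ is the simple graph with vertex set $V(G)\cup E(G)$ (disjoint union) in which two distinct elements are adjacent if and only if either both are vertices of $G$ that are adjacent in $G$, or one is a vertex of $G$ and the other is an edge of $G$ incident to it. The semitotal-line graph $T_2(G)$ is the simple graph with vertex set $V(G)\cup E(G)$ (disjoint union) in which two distinct elements are adjacent if and only if either both are edges of $G$ that are adjacent in $G$ (i.e. share an endpoint), or one is a vertex of $G$ and the other is an edge of $G$ incident to it. *)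

theory Defs
  imports Main
begin

record 'a graph =
  verts :: "'a set"
  edges :: "'a set set"

text \<open>An edge joining \<open>u\<close> and \<open>v\<close> is the two-element set \<open>{u, v}\<close>.\<close>

definition finite_simple_graph :: "'a graph \<Rightarrow> bool" where
  "finite_simple_graph G \<longleftrightarrow>
     finite (verts G) \<and> (\<forall>e \<in> edges G. e \<subseteq> verts G \<and> card e = 2)"

definition adjacent :: "'a graph \<Rightarrow> 'a \<Rightarrow> 'a \<Rightarrow> bool" where
  "adjacent G u v \<longleftrightarrow> {u, v} \<in> edges G"

definition connected_graph :: "'a graph \<Rightarrow> bool" where
  "connected_graph G \<longleftrightarrow> (\<forall>u \<in> verts G. \<forall>v \<in> verts G. (adjacent G)\<^sup>*\<^sup>* u v)"

definition degree :: "'a graph \<Rightarrow> 'a \<Rightarrow> nat" where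
  "degree G v = card {e \<in> edges G. v \<in> e}"

definition F_index :: "'a graph \<Rightarrow> nat" where
  "F_index G = (\<Sum>v \<in> verts G. degree G v ^ 3)"

definition xi4 :: "'a graph \<Rightarrow> nat" where
  "xi4 G = (\<Sum>v \<in> verts G. degree G v ^ 4)"

text \<open>
  For \<open>e = {u, v}\<close> with \<open>u \<noteq> v\<close> the summand is \<open>d(u) d(v) (d(u) + d(v))\<close>; taking the product
  and the sum over the set \<open>e\<close> avoids choosing an order of the endpoints.
\<close>

definition ReZG3 :: "'a graph \<Rightarrow> nat" where
  "ReZG3 G = (\<Sum>e \<in> edges G. (\<Prod>v \<in> e. degree G v) * (\<Sum>v \<in> e. degree G v))"

lemma ReZG3_summand:
  assumes "u \<noteq> v"
  shows "(\<Prod>w \<in> {u, v}. degree G w) * (\<Sum>w \<in> {u, v}. degree G w) =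
         degree G u * degree G v * (degree G u + degree G v)"
  using assms by simp

definition graph_of_relation :: "'a set \<Rightarrow> ('a \<Rightarrow> 'a \<Rightarrow> bool) \<Rightarrow> 'a graph" where
  "graph_of_relation V R =
     \<lparr>verts = V, edges = {{x, y} |x y. x \<in> V \<and> y \<in> V \<and> x \<noteq> y \<and> R x y}\<rparr>"

text \<open>
  In both derived graphs \<open>Inl v\<close> is a vertex \<open>v\<close> and \<open>Inr e\<close> an edge \<open>e\<close> of the original graph.
  The relations are only used between distinct elements.
\<close>

fun semitotal_point_adj :: "'a graph \<Rightarrow> 'a + 'a set \<Rightarrow> 'a + 'a set \<Rightarrow> bool" where
  "semitotal_point_adj G (Inl u) (Inl v) \<longleftrightarrow> adjacent G u v"
| "semitotal_point_adj G (Inl v) (Inr e) \<longleftrightarrow> v \<in> e"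
| "semitotal_point_adj G (Inr e) (Inl v) \<longleftrightarrow> v \<in> e"
| "semitotal_point_adj G (Inr e) (Inr f) \<longleftrightarrow> False"

definition semitotal_point :: "'a graph \<Rightarrow> ('a + 'a set) graph" where
  "semitotal_point G = graph_of_relation (verts G <+> edges G) (semitotal_point_adj G)"

fun semitotal_line_adj :: "'a graph \<Rightarrow> 'a + 'a set \<Rightarrow> 'a + 'a set \<Rightarrow> bool" where
  "semitotal_line_adj G (Inl u) (Inl v) \<longleftrightarrow> False"
| "semitotal_line_adj G (Inl v) (Inr e) \<longleftrightarrow> v \<in> e"
| "semitotal_line_adj G (Inr e) (Inl v) \<longleftrightarrow> v \<in> e"
| "semitotal_line_adj G (Inr e) (Inr f) \<longleftrightarrow> e \<inter> f \<noteq> {}"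

definition semitotal_line :: "'a graph \<Rightarrow> ('a + 'a set) graph" where
  "semitotal_line G = graph_of_relation (verts G <+> edges G) (semitotal_line_adj G)"

lemma finite_simple_graph_of_relation:
  "finite V \<Longrightarrow> finite_simple_graph (graph_of_relation V R)"
  by (auto simp: finite_simple_graph_def graph_of_relation_def)

lemma adjacent_graph_of_relation:
  assumes "symp R"
  shows "adjacent (graph_of_relation V R) x y \<longleftrightarrow> x \<in> V \<and> y \<in> V \<and> x \<noteq> y \<and> R x y"
  using assms by (auto simp: adjacent_def graph_of_relation_def doubleton_eq_iff dest: sympD)

lemma finite_edges: "finite_simple_graph G \<Longrightarrow> finite (edges G)"
  by (rule finite_subset[of _ "Pow (verts G)"]) (auto simp: finite_simple_graph_def)

lemma finite_simple_graph_semitotal: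
  assumes "finite_simple_graph G"
  shows "finite_simple_graph (semitotal_point G)" "finite_simple_graph (semitotal_line G)"
  using assms finite_edges[OF assms]
  by (auto simp: semitotal_point_def semitotal_line_def finite_simple_graph_def[of G]
      intro!: finite_simple_graph_of_relation finite_Plus)

lemma symp_semitotal_point_adj: "symp (semitotal_point_adj G)"
proof (rule sympI)
  fix x y assume "semitotal_point_adj G x y"
  then show "semitotal_point_adj G y x"
    by (cases x; cases y) (auto simp: adjacent_def insert_commute)
qed

lemma symp_semitotal_line_adj: "symp (semitotal_line_adj G)"
proof (rule sympI)
  fix x y assume "semitotal_line_adj G x y"
  then show "semitotal_line_adj G y x"
    by (cases x; cases y) auto
qed

end

theory Submission imports Defs begin

text \<open>
  A vertex has degree \<open>2 d(v)\<close> in the semitotal-point graph and \<open>d(v)\<close> in the semitotal-line graph,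
  while an edge \<open>uv\<close> has degree \<open>2\<close> and \<open>d(u) + d(v)\<close> respectively. Part (ii) then follows by
  expanding \<open>(d(u) + d(v))\<^sup>3\<close> and counting the incident pairs \<open>(v, e)\<close>, weighted by \<open>d(v)\<^sup>3\<close>, in two ways.
\<close>

lemma finite_simple_graphD:
  assumes "finite_simple_graph G"
  shows "finite (verts G)" "finite (edges G)"
    and "e \<in> edges G \<Longrightarrow> e \<subseteq> verts G" "e \<in> edges G \<Longrightarrow> card e = 2"
  using assms finite_edges[OF assms] by (auto simp: finite_simple_graph_def)

text \<open>Needed for counting the edges that meet a given edge: a second edge cannot share both
  ends with it.\<close>

lemma edge_eq_insert:
  assumes "finite_simple_graph G" "e \<in> edges G" "u \<in> e" "v \<in> e" "u \<noteq> v"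
  shows "e = {u, v}"
proof -
  have "card e = 2"
    using assms finite_simple_graphD(4) by metis
  moreover from this have "finite e"
    by (intro card_ge_0_finite) simp
  ultimately have "{u, v} = e"
    using assms(3-5) by (intro card_subset_eq) auto
  then show ?thesis ..
qed

text \<open>The map sending \<open>w\<close> to \<open>{v, w}\<close> is a bijection from neighbours
  to incident edges. This form suits derived graphs, which are given by adjacency relations.\<close>

lemma degree_eq_card_neighbours:
  assumes "finite_simple_graph G"
  shows "degree G v = card {w \<in> verts G. adjacent G v w}"
proof -
  have "bij_betw (\<lambda>w. {v, w}) {w \<in> verts G. adjacent G v w} {e \<in> edges G. v \<in> e}"
    unfolding bij_betw_def
  proof
    show "inj_on (\<lambda>w. {v, w}) {w \<in> verts G. adjacent G v w}"
      by (auto simp: inj_on_def doubleton_eq_iff)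
    show "(\<lambda>w. {v, w}) ` {w \<in> verts G. adjacent G v w} = {e \<in> edges G. v \<in> e}"
    proof (intro set_eqI iffI)
      fix e assume "e \<in> {e \<in> edges G. v \<in> e}"
      then have e: "e \<in> edges G" "v \<in> e" by auto
      then obtain x y where "e = {x, y}"
        using finite_simple_graphD(4)[OF assms] by (meson card_2_iff)
      with e(2) obtain w where "e = {v, w}" by fastforce
      with e finite_simple_graphD(3)[OF assms e(1)]
      show "e \<in> (\<lambda>w. {v, w}) ` {w \<in> verts G. adjacent G v w}"
        by (auto simp: adjacent_def)
    qed (auto simp: adjacent_def)
  qed
  then show ?thesis
    by (simp add: degree_def bij_betw_same_card)
qed

lemma degree_graph_of_relation:
  assumes "finite V" "symp R" "x \<in> V"
  shows "degree (graph_of_relation V R) x = card {y \<in> V. x \<noteq> y \<and> R x y}"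
  using assms
  by (simp add: degree_eq_card_neighbours finite_simple_graph_of_relation
      adjacent_graph_of_relation)
     (simp add: graph_of_relation_def conj_commute cong: conj_cong)

text \<open>A vertex keeps its old neighbours and gains its incident edges, equally many; an edge
  sees only its two ends.\<close>

lemma degree_semitotal_point:
  assumes G: "finite_simple_graph G"
  shows "v \<in> verts G \<Longrightarrow> degree (semitotal_point G) (Inl v) = 2 * degree G v"
    and "e \<in> edges G \<Longrightarrow> degree (semitotal_point G) (Inr e) = 2"
proof -
  note fin = finite_simple_graphD[OF G]
  note deg = degree_graph_of_relation[OF finite_Plus[OF fin(1,2)] symp_semitotal_point_adj[of G],
      folded semitotal_point_def]
  show "degree (semitotal_point G) (Inl v) = 2 * degree G v" if v: "v \<in> verts G"
  proof -
    \<comment> \<open>A loop would be the edge \<open>{v, v} = {v}\<close>, of cardinality 1. Hence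
      the condition \<open>Inl v \<noteq> y\<close> removes no neighbour.\<close>
    have irrefl: "\<not> adjacent G v v"
      using fin(4)[of "{v}"] by (auto simp: adjacent_def)
    have "{y \<in> verts G <+> edges G. Inl v \<noteq> y \<and> semitotal_point_adj G (Inl v) y} =
        {w \<in> verts G. adjacent G v w} <+> {e \<in> edges G. v \<in> e}"
      using irrefl by auto
    then have "degree (semitotal_point G) (Inl v) =
        card ({w \<in> verts G. adjacent G v w} <+> {e \<in> edges G. v \<in> e})"
      using deg[OF InlI[OF v]] by simp
    also have "\<dots> = card {w \<in> verts G. adjacent G v w} + card {e \<in> edges G. v \<in> e}"
      using fin by (intro card_Plus) auto
    finally show ?thesis
      using degree_eq_card_neighbours[OF G, of v] by (simp add: degree_def)
  qed
  show "degree (semitotal_point G) (Inr e) = 2" if e: "e \<in> edges G"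
  proof -
    have "{y \<in> verts G <+> edges G. Inr e \<noteq> y \<and> semitotal_point_adj G (Inr e) y} = Inl ` e"
      using fin(3)[OF e] by auto
    then show ?thesis
      using deg[OF InrI[OF e]] fin(4)[OF e] by (simp add: card_image)
  qed
qed

text \<open>A vertex sees only its incident edges. An edge \<open>{u, v}\<close> sees its two ends,
  \<open>d(u) - 1\<close> other edges at \<open>u\<close> and \<open>d(v) - 1\<close> at
  \<open>v\<close>.\<close>

lemma degree_semitotal_line:
  assumes G: "finite_simple_graph G"
  shows "v \<in> verts G \<Longrightarrow> degree (semitotal_line G) (Inl v) = degree G v"
    and "e \<in> edges G \<Longrightarrow> degree (semitotal_line G) (Inr e) = (\<Sum>v\<in>e. degree G v)"
proof -
  note fin = finite_simple_graphD[OF G]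
  note deg = degree_graph_of_relation[OF finite_Plus[OF fin(1,2)] symp_semitotal_line_adj[of G],
      folded semitotal_line_def]
  show "degree (semitotal_line G) (Inl v) = degree G v" if v: "v \<in> verts G"
  proof -
    have "{y \<in> verts G <+> edges G. Inl v \<noteq> y \<and> semitotal_line_adj G (Inl v) y} =
        Inr ` {e \<in> edges G. v \<in> e}"
      by auto
    then show ?thesis
      using deg[OF InlI[OF v]] by (simp add: card_image degree_def[of G])
  qed
  show "degree (semitotal_line G) (Inr e) = (\<Sum>v\<in>e. degree G v)" if e: "e \<in> edges G"
  proof -
    obtain u v where uv: "e = {u, v}" "u \<noteq> v"
      using fin(4)[OF e] by (meson card_2_iff)
    let ?I = "\<lambda>w. {f \<in> edges G. w \<in> f}"
    have finI: "finite (?I w)" for w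
      using fin(2) by simp
    have "{y \<in> verts G <+> edges G. Inr e \<noteq> y \<and> semitotal_line_adj G (Inr e) y} =
        e <+> ((?I u - {e}) \<union> (?I v - {e}))"
      using fin(3)[OF e] uv by auto
    then have "degree (semitotal_line G) (Inr e) = card (e <+> ((?I u - {e}) \<union> (?I v - {e})))"
      using deg[OF InrI[OF e]] by simp
    also have "\<dots> = card e + card ((?I u - {e}) \<union> (?I v - {e}))"
      using finI uv(1) by (intro card_Plus) auto
    \<comment> \<open>Disjoint because an edge through both \<open>u\<close> and \<open>v\<close> is
      \<open>e\<close> itself.\<close>
    also have "card ((?I u - {e}) \<union> (?I v - {e})) = card (?I u - {e}) + card (?I v - {e})"
      using finI uv edge_eq_insert[OF G] by (intro card_Un_disjoint) auto
    \<comment> \<open>The two ends of \<open>e\<close> make up for \<open>e\<close> having been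
      removed from each incidence set.\<close>
    also have "card e + \<dots> = Suc (card (?I u - {e})) + Suc (card (?I v - {e}))"
      using fin(4)[OF e] by simp
    also have "\<dots> = card (?I u) + card (?I v)"
      using finI e uv(1) by (simp only: card_Suc_Diff1 mem_Collect_eq insert_iff simp_thms)
    finally show ?thesis
      using uv by (simp add: degree_def)
  qed
qed

lemma sum_edges_sum_ends:
  fixes f :: "'a \<Rightarrow> nat"
  assumes G: "finite_simple_graph G"
  shows "(\<Sum>e\<in>edges G. \<Sum>v\<in>e. f v) = (\<Sum>v\<in>verts G. degree G v * f v)"
proof -
  note fin = finite_simple_graphD[OF G]
  \<comment> \<open>Writing \<open>e\<close> as a filter of \<open>verts G\<close> makes both index
    sets fixed, so the sums can be swapped.\<close>
  have "(\<Sum>e\<in>edges G. \<Sum>v\<in>e. f v) = (\<Sum>e\<in>edges G. \<Sum>v | v \<in> verts G \<and> v \<in> e. f v)"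
    using fin(3) by (intro sum.cong) auto
  also have "\<dots> = (\<Sum>v\<in>verts G. \<Sum>e | e \<in> edges G \<and> v \<in> e. f v)"
    using fin(2,1) by (rule sum.swap_restrict)
  finally show ?thesis
    by (simp add: degree_def)
qed

text \<open>This is \<open>(a + b)^3 = a^3 + b^3 + 3ab(a + b)\<close>, with the last term shaped
  like the summand of \<open>ReZG3\<close>.\<close>

lemma sum_cubed_edge:
  fixes f :: "'a \<Rightarrow> nat"
  assumes "card e = 2"
  shows "(\<Sum>v\<in>e. f v) ^ 3 = (\<Sum>v\<in>e. f v ^ 3) + 3 * ((\<Prod>v\<in>e. f v) * (\<Sum>v\<in>e. f v))"
proof -
  obtain u v where "e = {u, v}" "u \<noteq> v"
    using assms by (meson card_2_iff)
  then show ?thesis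
    by (simp add: power3_eq_cube algebra_simps)
qed

lemma F_index_graph_of_relation_Plus:
  assumes "finite A" "finite B"
  shows "F_index (graph_of_relation (A <+> B) R) =
    (\<Sum>a\<in>A. degree (graph_of_relation (A <+> B) R) (Inl a) ^ 3) +
    (\<Sum>b\<in>B. degree (graph_of_relation (A <+> B) R) (Inr b) ^ 3)"
  using assms
  by (simp add: F_index_def graph_of_relation_def sum.Plus)

theorem theorem1:
  fixes G :: "'a graph" and n m :: nat
  assumes "finite_simple_graph G"
    and "connected_graph G"
    and "card (verts G) = n"
    and "card (edges G) = m"
  shows "F_index (semitotal_point G) = 8 * F_index G + 8 * m \<and>
         F_index (semitotal_line G) = F_index G + xi4 G + 3 * ReZG3 G"
proof
  note G = assms(1)
  note fin = finite_simple_graphD[OF G]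
  note F_Plus = F_index_graph_of_relation_Plus[OF fin(1,2)]
  show "F_index (semitotal_point G) = 8 * F_index G + 8 * m"
    \<comment> \<open>The definition is opened only to split the sum over vertices and edges, then
      folded back for the degree lemmas. Each edge contributes \<open>2^3 = 8\<close>.\<close>
    unfolding semitotal_point_def F_Plus
    unfolding semitotal_point_def[symmetric]
    using assms(4)
    by (simp add: degree_semitotal_point[OF G] F_index_def power_mult_distrib sum_distrib_left)
  have "(\<Sum>e\<in>edges G. (\<Sum>v\<in>e. degree G v) ^ 3) =
      (\<Sum>e\<in>edges G. \<Sum>v\<in>e. degree G v ^ 3) + 3 * ReZG3 G"
    using fin(4) by (simp add: sum_cubed_edge ReZG3_def sum.distrib sum_distrib_left)
  \<comment> \<open>Double counting multiplies each cube by one more factor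
    \<open>degree G v\<close>, giving fourth powers.\<close>
  also have "(\<Sum>e\<in>edges G. \<Sum>v\<in>e. degree G v ^ 3) = xi4 G"
    by (simp add: sum_edges_sum_ends[OF G] xi4_def flip: power_Suc)
  finally show "F_index (semitotal_line G) = F_index G + xi4 G + 3 * ReZG3 G"
    unfolding semitotal_line_def F_Plus
    unfolding semitotal_line_def[symmetric]
    by (simp add: degree_semitotal_line[OF G] F_index_def)
qed

end
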